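(* Let $m\in\mathbb{N}$ and let $X$ stand for $l^G_\infty$ or $c^G$. Then $$\left[X(\Delta^m_G)\right]^\alpha=\Big\{a=(a_k)\in\omega(G):\ {}_G\sum_{k=1}^\infty e^{k^m}\odot|a_k|^G<\infty\Big\}.$$
   Context: Geometric arithmetic: the map $z\mapsto e^z$ is used as a generator, i.e. it is treated as a bijection from $\mathbb{C}$ onto the set of geometric complex numbers $\mathbb{C}(G)=\{e^z:z\in\mathbb{C}\}$, with inverse $\ln$. Operations: $x\oplus y=e^{\ln x+\ln y}=xy$, $x\ominus y=e^{\ln x-\ln y}=x/y$, $x\odot y=e^{\ln x\cdot\ln y}$; the geometric zero is $1$ and the identity is $e$. Geometric modulus: $|e^z|^G=e^{|z|}\in[1,\infty)$, compared in the usual order of the reals. ${}_G\sum_{k=1}^\infty x_k$ is the geometric limit of the partial sums $x_1\oplus\cdots\oplus x_n$; for real terms $x_k\ge1$, "$<\infty$" means these (increasing) partial sums are bounded. $\mathbb{N}=\{1,2,\dots\}$. $\omega(G)$ is the set of all sequences $x=(x_k)_{k\ge1}$ in $\mathbb{C}(G)$. Set $l_\infty^G=\{x\in\omega(G):\sup_k|x_k|^G<\infty\}$, $c^G=\{x\in\omega(G):|x_k\ominus l|^G\to1\text{ for some }l\in\mathbb{C}(G)\}$. Differences: $\Delta^0_Gx=x$, $\Delta_G^mx=(\Delta^m_Gx_k)_k$ with $\Delta^m_Gx_k=\Delta^{m-1}_Gx_k\ominus\Delta^{m-1}_Gx_{k+1}$. For $X\in\{l_\infty^G,c^G\}$, $X(\Delta^m_G)=\{x\in\omega(G):\Delta^m_Gx\in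 X\}$. $\alpha$-dual: for $Y\subseteq\omega(G)$, $Y^\alpha=\{a=(a_k)\in\omega(G):{}_G\sum_{k=1}^\infty|a_k\odot x_k|^G<\infty\text{ for each }x\in Y\}$. *)

theory Defs
  imports Complex_Main "HOL-Library.FuncSet"
begin

text \<open>
  Geometric arithmetic treats the generator \<open>z \<mapsto> e\<^sup>z\<close> as a bijection from the complex numbers onto
  the geometric complex numbers, with inverse \<open>ln\<close>.  The complex exponential is not injective, so
  the geometric complex numbers are a copy of the complex numbers: \<open>gexp z\<close> is the element written
  \<open>e\<^sup>z\<close>, and \<open>gln\<close> is the inverse of the generator.  The function \<open>gval\<close> recovers the
  underlying complex number.
\<close>

datatype gcomplex = gexp (gln: complex)

definition gval :: "gcomplex \<Rightarrow> complex" where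
  "gval x = exp (gln x)"

definition gadd :: "gcomplex \<Rightarrow> gcomplex \<Rightarrow> gcomplex"  (infixl "\<oplus>\<^sub>G" 65) where
  "x \<oplus>\<^sub>G y = gexp (gln x + gln y)"

definition gdiff :: "gcomplex \<Rightarrow> gcomplex \<Rightarrow> gcomplex"  (infixl "\<ominus>\<^sub>G" 65) where
  "x \<ominus>\<^sub>G y = gexp (gln x - gln y)"

definition gmult :: "gcomplex \<Rightarrow> gcomplex \<Rightarrow> gcomplex"  (infixl "\<odot>\<^sub>G" 70) where
  "x \<odot>\<^sub>G y = gexp (gln x * gln y)"

lemma bij_gexp: "bij gexp"
  by (rule bij_betw_byWitness[where f' = gln]) auto

lemma gval_gexp: "gval (gexp z) = exp z"
  by (simp add: gval_def)

lemma gval_gadd: "gval (x \<oplus>\<^sub>G y) = gval x * gval y"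
  by (simp add: gval_def gadd_def exp_add)

lemma gval_gdiff: "gval (x \<ominus>\<^sub>G y) = gval x / gval y"
  by (simp add: gval_def gdiff_def exp_diff)

text \<open>
  On the reals the generator is injective, so geometric reals are just positive real numbers, and
  the geometric modulus takes values in the ordinary reals.
\<close>

definition radd :: "real \<Rightarrow> real \<Rightarrow> real"  (infixl "\<oplus>\<^sub>R" 65) where
  "x \<oplus>\<^sub>R y = exp (ln x + ln y)"

definition rmult :: "real \<Rightarrow> real \<Rightarrow> real"  (infixl "\<odot>\<^sub>R" 70) where
  "x \<odot>\<^sub>R y = exp (ln x * ln y)"

definition gmod :: "gcomplex \<Rightarrow> real" where
  "gmod x = exp (cmod (gln x))"

lemma radd_eq_times: "x > 0 \<Longrightarrow> y > 0 \<Longrightarrow> x \<oplus>\<^sub>R y = x * y"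
  by (simp add: radd_def exp_add)

lemma gmod_gexp: "gmod (gexp z) = exp (cmod z)"
  by (simp add: gmod_def)

lemma gmod_ge_1: "gmod x \<ge> 1"
  by (simp add: gmod_def)

text \<open>
  The partial sums \<open>f 1 \<oplus> \<dots> \<oplus> f n\<close>; the empty one is the geometric zero \<open>1\<close>.
  The predicate \<open>gsum_finite\<close> is meant for terms \<open>f k \<ge> 1\<close>, whose partial sums increase.
\<close>

primrec gpartial_sum :: "(nat \<Rightarrow> real) \<Rightarrow> nat \<Rightarrow> real" where
  "gpartial_sum f 0 = 1"
| "gpartial_sum f (Suc n) = gpartial_sum f n \<oplus>\<^sub>R f (Suc n)"

definition gsum_finite :: "(nat \<Rightarrow> real) \<Rightarrow> bool" where
  "gsum_finite f \<longleftrightarrow> bdd_above (range (gpartial_sum f))"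

text \<open>
  Sequences are indexed by \<open>k \<ge> 1\<close>: they are extensional functions on \<open>{1..}\<close>, so the value at \<open>0\<close>
  is fixed and carries no information.
\<close>

definition omega_G :: "(nat \<Rightarrow> gcomplex) set" where
  "omega_G = {1..} \<rightarrow>\<^sub>E UNIV"

definition linf_G :: "(nat \<Rightarrow> gcomplex) set" where
  "linf_G = {x \<in> omega_G. bdd_above ((\<lambda>k. gmod (x k)) ` {1..})}"

definition c_G :: "(nat \<Rightarrow> gcomplex) set" where
  "c_G = {x \<in> omega_G. \<exists>l. (\<lambda>k. gmod (x k \<ominus>\<^sub>G l)) \<longlonglongrightarrow> 1}"

definition Delta_G :: "(nat \<Rightarrow> gcomplex) \<Rightarrow> nat \<Rightarrow> gcomplex" where
  "Delta_G x = (\<lambda>k\<in>{1..}. x k \<ominus>\<^sub>G x (k + 1))"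

definition diff_space :: "(nat \<Rightarrow> gcomplex) set \<Rightarrow> nat \<Rightarrow> (nat \<Rightarrow> gcomplex) set" where
  "diff_space X m = {x \<in> omega_G. (Delta_G ^^ m) x \<in> X}"

definition alpha_dual :: "(nat \<Rightarrow> gcomplex) set \<Rightarrow> (nat \<Rightarrow> gcomplex) set" where
  "alpha_dual Y = {a \<in> omega_G. \<forall>x\<in>Y. gsum_finite (\<lambda>k. gmod (a k \<odot>\<^sub>G x k))}"

end

theory Submission
  imports Defs
begin

text \<open>
  Taking logarithms reduces the claim to complex sequences: \<open>\<Sum> |a\<^sub>k x\<^sub>k| < \<infinity>\<close> for all \<open>x\<close> whose
  \<open>m\<close>-th difference is bounded (convergent) iff \<open>\<Sum> k\<^sup>m |a\<^sub>k| < \<infinity>\<close>.  If the \<open>m\<close>-th difference of \<open>x\<close>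
  is bounded, then \<open>x\<^sub>k = O(k\<^sup>m)\<close> by repeated summation.  Conversely, \<open>x\<^sub>k = (k + m choose m)\<close> has
  constant \<open>m\<close>-th difference \<open>(-1)\<^sup>m\<close> and grows at least like \<open>(k / m)\<^sup>m\<close>.
\<close>

lemma gpartial_sum_exp: "gpartial_sum (\<lambda>k. exp (g k)) n = exp (\<Sum>k=1..n. g k)"
  by (induction n) (auto simp: radd_def)

lemma gsum_finite_exp_iff:
  "gsum_finite (\<lambda>k. exp (g k)) \<longleftrightarrow> (\<exists>M. \<forall>n. (\<Sum>k=1..n. g k) \<le> M)"
proof
  assume "gsum_finite (\<lambda>k. exp (g k))"
  then obtain B where B: "\<And>n. exp (\<Sum>k=1..n. g k) \<le> B"
    by (auto simp: gsum_finite_def bdd_above_def gpartial_sum_exp)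
  have "(\<Sum>k=1..n. g k) \<le> ln B" for n
    using B[of n] by (meson exp_gt_zero ln_ge_iff order_less_le_trans)
  then show "\<exists>M. \<forall>n. (\<Sum>k=1..n. g k) \<le> M"
    by blast
next
  assume "\<exists>M. \<forall>n. (\<Sum>k=1..n. g k) \<le> M"
  then obtain M where "\<And>n. (\<Sum>k=1..n. g k) \<le> M"
    by blast
  then show "gsum_finite (\<lambda>k. exp (g k))"
    by (auto simp: gsum_finite_def gpartial_sum_exp intro!: bdd_aboveI[where M = "exp M"])
qed

text \<open>Comparison test in logarithmic form. Both inclusions of the theorem end with it:
  \<open>C\<close> absorbs the constant from the growth bound or from the binomial estimate.\<close>

lemma gsum_finite_exp_comparison:
  assumes "gsum_finite (\<lambda>k. exp (h k))" and "C \<ge> 0" and le: "\<And>k. k \<ge> 1 \<Longrightarrow> g k \<le> C * h k"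
  shows "gsum_finite (\<lambda>k. exp (g k))"
proof -
  obtain M where M: "\<And>n. (\<Sum>k=1..n. h k) \<le> M"
    using assms(1) by (auto simp: gsum_finite_exp_iff)
  have "(\<Sum>k=1..n. g k) \<le> C * M" for n
  proof -
    have "(\<Sum>k=1..n. g k) \<le> C * (\<Sum>k=1..n. h k)"
      unfolding sum_distrib_left by (intro sum_mono le) simp
    also have "\<dots> \<le> C * M"
      using M \<open>C \<ge> 0\<close> by (rule mult_left_mono)
    finally show ?thesis .
  qed
  then show ?thesis
    by (auto simp: gsum_finite_exp_iff)
qed

lemma gmod_gmult: "gmod (x \<odot>\<^sub>G y) = exp (cmod (gln x) * cmod (gln y))"
  by (simp add: gmod_def gmult_def norm_mult)

lemma exp_rmult_gmod: "exp t \<odot>\<^sub>R gmod x = exp (t * cmod (gln x))"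
  by (simp add: gmod_def rmult_def)

lemma gln_Delta_G: "k \<ge> 1 \<Longrightarrow> gln (Delta_G x k) = gln (x k) - gln (x (Suc k))"
  by (simp add: Delta_G_def gdiff_def)

lemma linf_G_iff:
  "x \<in> linf_G \<longleftrightarrow> x \<in> omega_G \<and> (\<exists>C. \<forall>k\<ge>1. cmod (gln (x k)) \<le> C)"
proof -
  have "bdd_above ((\<lambda>k. gmod (x k)) ` {1..}) \<longleftrightarrow> (\<exists>C. \<forall>k\<ge>1. cmod (gln (x k)) \<le> C)"
  proof
    assume "bdd_above ((\<lambda>k. gmod (x k)) ` {1..})"
    then obtain B where B: "\<And>k. k \<ge> 1 \<Longrightarrow> exp (cmod (gln (x k))) \<le> B"
      by (auto simp: bdd_above_def gmod_def)
    then have "cmod (gln (x k)) \<le> ln B" if "k \<ge> 1" for k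
      using that by (meson exp_gt_zero ln_ge_iff order_less_le_trans)
    then show "\<exists>C. \<forall>k\<ge>1. cmod (gln (x k)) \<le> C"
      by blast
  next
    assume "\<exists>C. \<forall>k\<ge>1. cmod (gln (x k)) \<le> C"
    then obtain C where "\<And>k. k \<ge> 1 \<Longrightarrow> cmod (gln (x k)) \<le> C"
      by blast
    then show "bdd_above ((\<lambda>k. gmod (x k)) ` {1..})"
      by (auto simp: gmod_def intro!: bdd_aboveI[where M = "exp C"])
  qed
  then show ?thesis
    by (auto simp: linf_G_def)
qed

text \<open>Continuity of \<open>ln\<close> at 1 turns geometric convergence into ordinary
  convergence of the logarithms, and a convergent complex sequence is bounded.\<close>

lemma c_G_subset_linf_G: "c_G \<subseteq> linf_G"
proof
  fix x assume "x \<in> c_G"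
  then obtain l where x: "x \<in> omega_G" and "(\<lambda>k. gmod (x k \<ominus>\<^sub>G l)) \<longlonglongrightarrow> 1"
    by (auto simp: c_G_def)
  then have "(\<lambda>k. ln (gmod (x k \<ominus>\<^sub>G l))) \<longlonglongrightarrow> ln 1"
    by (intro tendsto_ln) auto
  then have "(\<lambda>k. gln (x k) - gln l) \<longlonglongrightarrow> 0"
    by (simp add: gmod_def gdiff_def tendsto_norm_zero_iff)
  then have "(\<lambda>k. gln (x k)) \<longlonglongrightarrow> gln l"
    by (simp add: LIM_zero_iff)
  then have "Bseq (\<lambda>k. gln (x k))"
    by (meson convergentI convergent_imp_Bseq)
  with x show "x \<in> linf_G"
    by (auto simp: linf_G_iff Bseq_def)
qed

text \<open>Induction on \<open>m\<close>, with the innermost difference split off so that the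
  induction hypothesis applies to \<open>Delta_G x\<close>. Summing increments of order k^m gives
  growth of order k^(m+1).\<close>

lemma gln_growth:
  assumes "\<exists>C. \<forall>k\<ge>1. cmod (gln ((Delta_G ^^ m) x k)) \<le> C"
  shows "\<exists>C\<ge>0. \<forall>k\<ge>1. cmod (gln (x k)) \<le> C * real k ^ m"
  using assms
proof (induction m arbitrary: x)
  case 0
  then obtain C where "\<forall>k\<ge>1. cmod (gln (x k)) \<le> C"
    by auto
  then show ?case
    by (intro exI[of _ "max 0 C"]) (auto simp: le_max_iff_disj)
next
  case (Suc m)
  then have "\<exists>C. \<forall>k\<ge>1. cmod (gln ((Delta_G ^^ m) (Delta_G x) k)) \<le> C"
    by (simp add: funpow_Suc_right del: funpow.simps)
  from Suc.IH[OF this] obtain C where "C \<ge> 0"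
    and C: "\<And>k. k \<ge> 1 \<Longrightarrow> cmod (gln (Delta_G x k)) \<le> C * real k ^ m"
    by blast
  \<comment> \<open>\<open>K\<close> dominates both the starting value at index 1 and the constant
    of the increments, so one constant serves the whole inner induction.\<close>
  define K where "K = C + cmod (gln (x 1))"
  have K: "K \<ge> C" "K \<ge> cmod (gln (x 1))" "K \<ge> 0"
    using \<open>C \<ge> 0\<close> by (auto simp: K_def)
  have "cmod (gln (x k)) \<le> K * real k ^ Suc m" if "k \<ge> 1" for k
    using that
  proof (induction k rule: dec_induct)
    case base
    then show ?case using K by simp
  next
    case (step k)
    have "cmod (gln (x (Suc k))) = cmod (gln (x k) - gln (Delta_G x k))"
      using step.hyps by (simp add: gln_Delta_G)
    also have "\<dots> \<le> cmod (gln (x k)) + cmod (gln (Delta_G x k))"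
      by (rule norm_triangle_ineq4)
    also have "\<dots> \<le> K * real k ^ Suc m + K * real k ^ m"
      using step.IH C[OF step.hyps(1)] mult_right_mono[OF K(1), of "real k ^ m"] by simp
    \<comment> \<open>The two powers combine as k^(m+1) + k^m = (k+1) k^m.\<close>
    also have "\<dots> = K * (real (Suc k) * real k ^ m)"
      by (simp add: algebra_simps)
    also have "\<dots> \<le> K * (real (Suc k) * real (Suc k) ^ m)"
      using K by (intro mult_left_mono power_mono) auto
    finally show ?case by simp
  qed
  with K show ?case by blast
qed

text \<open>Test sequences for the dual. The factor \<open>s\<close> carries the sign that each
  difference flips; the shift \<open>r\<close> stays fixed under differences.\<close>

definition binom_seq :: "nat \<Rightarrow> complex \<Rightarrow> nat \<Rightarrow> nat \<Rightarrow> gcomplex" where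
  "binom_seq r s j = (\<lambda>k\<in>{1..}. gexp (s * of_nat ((k + r) choose j)))"

text \<open>Pascal's rule for the upper entry k + r + 1.\<close>

lemma Delta_G_binom_seq: "Delta_G (binom_seq r s (Suc j)) = binom_seq r (-s) j"
  by (auto simp: Delta_G_def binom_seq_def gdiff_def fun_eq_iff algebra_simps)

lemma Delta_G_funpow_binom_seq:
  "(Delta_G ^^ j) (binom_seq r s j) = (\<lambda>k\<in>{1..}. gexp ((-1) ^ j * s))"
proof (induction j arbitrary: s)
  case 0
  then show ?case by (simp add: binom_seq_def)
next
  case (Suc j)
  then show ?case
    by (simp add: funpow_Suc_right Delta_G_binom_seq del: funpow.simps cong: if_cong)
qed

lemma binom_seq_in_diff_space: "binom_seq r s m \<in> diff_space c_G m"
proof -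
  have "(\<lambda>k\<in>{1..}. gexp z) \<in> c_G" for z
  proof -
    have "(\<lambda>k. gmod ((\<lambda>k\<in>{1..}. gexp z) k \<ominus>\<^sub>G gexp z)) \<longlonglongrightarrow> 1"
      \<comment> \<open>At index 0 the restricted function is \<open>undefined\<close>, so the
        modulus is known to equal 1 only from index 1 on.\<close>
      by (rule tendsto_eventually)
        (auto simp: eventually_sequentially gmod_def gdiff_def intro!: exI[of _ 1])
    moreover have "(\<lambda>k\<in>{1..}. gexp z) \<in> omega_G"
      by (simp add: omega_G_def)
    ultimately show ?thesis
      unfolding c_G_def by blast
  qed
  moreover have "binom_seq r s m \<in> omega_G"
    by (simp add: binom_seq_def omega_G_def)
  ultimately show ?thesis
    by (simp add: diff_space_def Delta_G_funpow_binom_seq)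
qed

text \<open>The standard bound (n/m)^m \<le> (n choose m) for n = k + m, multiplied by m^m.\<close>

lemma power_le_binomial: "real k ^ m \<le> real m ^ m * real ((k + m) choose m)"
proof (cases "m = 0")
  case False
  have "real k ^ m \<le> real (k + m) ^ m"
    by (intro power_mono) auto
  also have "\<dots> = real m ^ m * (real (k + m) / real m) ^ m"
    using False by (simp add: power_divide)
  also have "\<dots> \<le> real m ^ m * real ((k + m) choose m)"
    using binomial_ge_n_over_k_pow_k[of m "k + m", where 'a = real]
    by (intro mult_left_mono) auto
  finally show ?thesis .
qed simp

theorem theorem4p4:
  fixes m :: nat and X :: "(nat \<Rightarrow> gcomplex) set"
  assumes "m \<ge> 1" and "X = linf_G \<or> X = c_G"
  shows "alpha_dual (diff_space X m) =
    {a \<in> omega_G. gsum_finite (\<lambda>k. exp (real k ^ m) \<odot>\<^sub>R gmod (a k))}"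
proof (intro set_eqI iffI)
  \<comment> \<open>Both choices of \<open>X\<close> lie between \<open>c_G\<close> and
    \<open>linf_G\<close>. The lower end supplies the test sequence for one inclusion, the upper end
    the growth bound for the other.\<close>
  have X: "c_G \<subseteq> X" "X \<subseteq> linf_G"
    using assms(2) c_G_subset_linf_G by auto
  fix a
  {
    assume a: "a \<in> alpha_dual (diff_space X m)"
    \<comment> \<open>The shift is taken to be \<open>m\<close> so that the terms are the binomials
      of \<open>power_le_binomial\<close>.\<close>
    have "binom_seq m 1 m \<in> diff_space X m"
      using binom_seq_in_diff_space X(1) by (auto simp: diff_space_def)
    with a have "gsum_finite (\<lambda>k. exp (cmod (gln (a k)) * cmod (gln (binom_seq m 1 m k))))"
      by (auto simp: alpha_dual_def gmod_gmult)
    then have "gsum_finite (\<lambda>k. exp (real k ^ m * cmod (gln (a k))))"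
    proof (rule gsum_finite_exp_comparison[where C = "real m ^ m"])
      fix k :: nat assume "k \<ge> 1"
      then have "cmod (gln (binom_seq m 1 m k)) = real ((k + m) choose m)"
        by (simp add: binom_seq_def)
      then show "real k ^ m * cmod (gln (a k))
          \<le> real m ^ m * (cmod (gln (a k)) * cmod (gln (binom_seq m 1 m k)))"
        using mult_right_mono[OF power_le_binomial[of k m], of "cmod (gln (a k))"]
        by (simp add: mult_ac)
    qed simp
    with a show "a \<in> {a \<in> omega_G. gsum_finite (\<lambda>k. exp (real k ^ m) \<odot>\<^sub>R gmod (a k))}"
      by (simp add: alpha_dual_def exp_rmult_gmod)
  next
    assume a: "a \<in> {a \<in> omega_G. gsum_finite (\<lambda>k. exp (real k ^ m) \<odot>\<^sub>R gmod (a k))}"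
    then have fin: "gsum_finite (\<lambda>k. exp (real k ^ m * cmod (gln (a k))))"
      by (simp add: exp_rmult_gmod)
    have "gsum_finite (\<lambda>k. gmod (a k \<odot>\<^sub>G x k))" if "x \<in> diff_space X m" for x
    proof -
      have "(Delta_G ^^ m) x \<in> linf_G"
        using that X(2) by (auto simp: diff_space_def)
      then obtain C where "C \<ge> 0"
        and C: "\<And>k. k \<ge> 1 \<Longrightarrow> cmod (gln (x k)) \<le> C * real k ^ m"
        using gln_growth[of m x] by (auto simp: linf_G_iff)
      have "gsum_finite (\<lambda>k. exp (cmod (gln (a k)) * cmod (gln (x k))))"
        using fin \<open>C \<ge> 0\<close>
      proof (rule gsum_finite_exp_comparison)
        fix k :: nat assume "k \<ge> 1"
        then show "cmod (gln (a k)) * cmod (gln (x k)) \<le> C * (real k ^ m * cmod (gln (a k)))"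
          using mult_left_mono[OF C, of k "cmod (gln (a k))"] by (simp add: mult_ac)
      qed
      then show ?thesis
        by (simp add: gmod_gmult)
    qed
    with a show "a \<in> alpha_dual (diff_space X m)"
      by (simp add: alpha_dual_def)
  }
qed

end
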